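(* Let $\{\lambda_n\}_{n\in\mathbb{N}}$ be a sequence of positive real numbers, and for each $n$ let $T_n = \begin{pmatrix} A_n & B_n \\ C_n & D_n \end{pmatrix} \in \psi(M,N,\lambda_n)$. Let $T = \begin{pmatrix} A & B \\ C & D \end{pmatrix} \in \mathcal{B}(\mathcal{H},\mathcal{K})$ be such that $\mathcal{R}(D)$ is closed, and suppose $T_n \to T$ in the operator norm. If $\lambda_n \|D - D_n\| \to 0$, then $T \in \psi(M,N)$.
   Context: $\mathcal{H}$ and $\mathcal{K}$ are real or complex Hilbert spaces, $\mathcal{B}(\mathcal{H},\mathcal{K})$ is the space of bounded linear operators from $\mathcal{H}$ to $\mathcal{K}$, and $\mathcal{B}(\mathcal{H})=\mathcal{B}(\mathcal{H},\mathcal{H})$. $\mathcal{R}(\cdot)$ denotes range and $*$ denotes adjoint. $M\subseteq\mathcal{H}$ and $N\subseteq\mathcal{K}$ are closed subspaces. Block matrices are taken with respect to the orthogonal decompositions $\mathcal{H}=M\oplus M^\perp$ and $\mathcal{K}=N\oplus N^\perp$, so $T=\begin{pmatrix}A&B\\C&D\end{pmatrix}$ has $A:M\to N$, $B:M^\perp\to N$, $C:M\to N^\perp$, $D:M^\perp\to N^\perp$. For a closed subspace $L$, $\mathcal{B}_L=\{x\in L:\|x\|\le 1\}$. For $\lambda>0$, $T\in\mathcal{B}(\mathcal{H},\mathcal{K})$ is $(M,N,\lambda)$-complementable if $C(\mathcal{B}_M)\subseteq\lambda D(\mathcal{B}_{M^\perp})$ and $B^*(\mathcal{B}_N)\subseteq\lambda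 D^*(\mathcal{B}_{N^\perp})$; $\psi(M,N,\lambda)$ is the set of all such $T$. $T\in\mathcal{B}(\mathcal{H},\mathcal{K})$ is $(M,N)$-complementable if there are (bounded, idempotent) projections $P_r\in\mathcal{B}(\mathcal{H})$, $P_\ell\in\mathcal{B}(\mathcal{K})$ with ranges $M$ and $N$ respectively, and operators $M_r\in\mathcal{B}(\mathcal{H})$, $M_\ell\in\mathcal{B}(\mathcal{K})$ with $(I-P_r)M_r=M_r$, $(I-P_\ell)TM_r=(I-P_\ell)T$, $M_\ell(I-P_\ell)=M_\ell$, $M_\ell T(I-P_r)=T(I-P_r)$. It is known that this is equivalent to $\mathcal{R}(C)\subseteq\mathcal{R}(D)$ and $\mathcal{R}(B^* )\subseteq\mathcal{R}(D^* )$, and also to $T$ being $(M,N,\lambda)$-complementable for some $\lambda>0$. $\psi(M,N)$ is the set of all $(M,N)$-complementable operators. *)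

theory Defs
  imports "HOL-Analysis.Analysis"
begin

text \<open>
  The scalar field is real or complex. Since each z is a root of
  X^2 - (z + cnj z) X + norm z ^ 2, which has real coefficients, no other fields belong to
  this class: see \<open>rc_field_cases\<close> below.
\<close>

class rc_field = real_normed_field +
  fixes rcnj :: "'a \<Rightarrow> 'a"
  assumes rcnj_add: "rcnj (x + y) = rcnj x + rcnj y"
    and rcnj_mult: "rcnj (x * y) = rcnj x * rcnj y"
    and rcnj_rcnj: "rcnj (rcnj x) = x"
    and rcnj_scaleR_1: "rcnj (r *\<^sub>R 1) = r *\<^sub>R 1"
    and ex_add_rcnj: "\<exists>r. x + rcnj x = r *\<^sub>R 1"
    and mult_rcnj_scaleR_1: "x * rcnj x = ((norm x)\<^sup>2) *\<^sub>R 1"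

lemma rcnj_of_real: "rcnj (of_real r :: 'a::rc_field) = of_real r"
  by (simp add: of_real_def rcnj_scaleR_1)

lemma add_rcnj_Reals: "x + rcnj x \<in> (\<real> :: 'a::rc_field set)"
  using ex_add_rcnj[of x] by (auto simp: Reals_def of_real_def)

lemma mult_rcnj: "x * rcnj x = (of_real ((norm x)\<^sup>2) :: 'a::rc_field)"
  by (simp add: of_real_def mult_rcnj_scaleR_1)

instantiation real :: rc_field
begin
definition rcnj_real :: "real \<Rightarrow> real" where "rcnj_real x = x"
instance
  by standard (auto simp: rcnj_real_def power2_eq_square)
end

instantiation complex :: rc_field
begin
definition rcnj_complex :: "complex \<Rightarrow> complex" where "rcnj_complex = cnj"
instance
proof
  fix x :: complex
  show "\<exists>r. x + rcnj x = r *\<^sub>R 1"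
    by (rule exI[of _ "2 * Re x"])
       (simp add: rcnj_complex_def complex_add_cnj scaleR_conv_of_real)
  have "x * cnj x = complex_of_real ((norm x)\<^sup>2)"
    by (metis complex_norm_square of_real_power)
  then show "x * rcnj x = ((norm x)\<^sup>2) *\<^sub>R 1"
    by (simp only: rcnj_complex_def scaleR_conv_of_real mult_1_right)
qed (simp_all add: rcnj_complex_def scaleR_conv_of_real)
end

lemma rc_field_cases:
  "(\<forall>z :: 'k::rc_field. z \<in> \<real>) \<or>
   (\<exists>i :: 'k. i * i = -1 \<and> rcnj i = - i \<and> (\<forall>z. \<exists>a b. z = of_real a + of_real b * i))"
proof (cases "\<forall>z :: 'k. z \<in> \<real>")
  case False
  define im :: "'k \<Rightarrow> 'k" where "im z = (z - rcnj z) / 2" for z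
  have rcnj_diff: "rcnj (x - y) = rcnj x - rcnj y" for x y :: 'k
    using rcnj_add[of "x - y" y] by (metis diff_add_cancel add_diff_cancel_right')
  have half: "\<exists>a. z = of_real a + im z" for z :: 'k
  proof -
    obtain a where "z + rcnj z = of_real a"
      using add_rcnj_Reals[of z] by (auto simp: Reals_def)
    then have "z = of_real (a / 2) + im z"
      by (simp add: im_def eq_diff_eq flip: add_divide_distrib)
    then show ?thesis ..
  qed
  have half': "z \<in> \<real>" if "rcnj z = z" for z :: 'k
  proof -
    have "im z = 0" using that by (simp add: im_def)
    then show ?thesis using half[of z] by (metis Reals_of_real add.right_neutral)
  qed
  have rcnj_im: "rcnj (im z) = - im z" for z :: 'k
  proof -
    have "2 * im z = z - rcnj z"
      by (simp add: im_def)
    then have "rcnj (2 * im z) = - (2 * im z)"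
      by (simp only: rcnj_diff rcnj_rcnj minus_diff_eq)
    moreover have "rcnj (2 * im z) = 2 * rcnj (im z)"
      using rcnj_of_real[of 2, where 'a='k] by (simp add: rcnj_mult)
    ultimately show ?thesis by simp
  qed
  obtain w :: 'k where w: "w \<notin> \<real>" using False by blast
  have im0: "im w \<noteq> 0"
    using half[of w] w by (metis Reals_of_real add.right_neutral)
  define i where "i = im w / of_real (norm (im w))"
  have i_eq: "im w = of_real (norm (im w)) * i"
    using im0 by (simp add: i_def)
  have "of_real (norm (im w)) * rcnj i = of_real (norm (im w)) * (- i)"
    by (metis i_eq mult_minus_right rcnj_im rcnj_mult rcnj_of_real)
  then have ci: "rcnj i = - i"
    using im0 by (simp only: mult_cancel_left) simp
  have "norm i = 1" using im0 by (simp add: i_def norm_divide)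
  then have ii: "i * i = -1"
    using mult_rcnj[of i] by (metis ci minus_minus mult_minus_right of_real_1 power_one)
  have "\<exists>a b. z = of_real a + of_real b * i" for z :: 'k
  proof -
    obtain a where a: "z = of_real a + im z" using half by blast
    have "rcnj (im z * i) = im z * i"
      by (simp add: rcnj_mult rcnj_im ci)
    then have "im z * i \<in> \<real>" by (rule half')
    then obtain b where "im z * i = of_real b" by (rule Reals_cases)
    then have "im z * (i * i) = of_real b * i" by (metis mult.assoc)
    then have "- im z = of_real b * i" using ii by simp
    then have "im z = of_real (- b) * i" by (metis minus_minus mult_minus_left of_real_minus)
    with a have "z = of_real a + of_real (- b) * i" by metis
    then show ?thesis by blast
  qed
  with ci ii show ?thesis by blast
qed simp

text \<open>
  Hilbert spaces over \<open>'k\<close>: completeness comes from the sort of \<open>'a\<close>, and the last axiom says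
  that the norm is the one induced by the inner product. The inner product is linear in its
  first argument.
\<close>

locale hilbert_space = vector_space scale
  for scale :: "'k::rc_field \<Rightarrow> 'a::{real_normed_vector, complete_space} \<Rightarrow> 'a" +
  fixes ip :: "'a \<Rightarrow> 'a \<Rightarrow> 'k"
  assumes scale_of_real: "scale (of_real r) x = r *\<^sub>R x"
    and ip_add_left: "ip (x + y) z = ip x z + ip y z"
    and ip_scale_left: "ip (scale c x) y = c * ip x y"
    and ip_commute: "ip y x = rcnj (ip x y)"
    and ip_self: "ip x x = of_real ((norm x)\<^sup>2)"

lemma hilbert_space_real:
  "hilbert_space scaleR (inner :: 'a::{real_inner, complete_space} \<Rightarrow> 'a \<Rightarrow> real)"
  by unfold_locales
     (simp_all add: scaleR_add_right scaleR_add_left inner_add_left rcnj_real_def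
        power2_norm_eq_inner, rule inner_commute)

lemma hilbert_space_complex: "hilbert_space (*) (\<lambda>x y :: complex. x * cnj y)"
proof unfold_locales
  show "x * cnj x = complex_of_real ((norm x)\<^sup>2)" for x
    by (metis complex_norm_square of_real_power)
qed (simp_all add: distrib_left distrib_right rcnj_complex_def scaleR_conv_of_real)

definition bounded_ops ::
  "('k::rc_field \<Rightarrow> 'a::real_normed_vector \<Rightarrow> 'a) \<Rightarrow> ('k \<Rightarrow> 'b::real_normed_vector \<Rightarrow> 'b)
    \<Rightarrow> ('a \<Rightarrow>\<^sub>L 'b) set" where
  "bounded_ops sH sK = {T. Vector_Spaces.linear sH sK (blinfun_apply T)}"

definition orth_compl :: "('a::real_normed_vector \<Rightarrow> 'a \<Rightarrow> 'k::rc_field) \<Rightarrow> 'a set \<Rightarrow> 'a set" where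
  "orth_compl ip L = {x. \<forall>y\<in>L. ip x y = 0}"

text \<open>
  The projection exists and is unique when \<open>L\<close> is a closed subspace of a Hilbert space, and the
  adjoint when \<open>T\<close> is a bounded operator between Hilbert spaces.
\<close>

definition orth_proj ::
  "('a::real_normed_vector \<Rightarrow> 'a \<Rightarrow> 'k::rc_field) \<Rightarrow> 'a set \<Rightarrow> 'a \<Rightarrow>\<^sub>L 'a" where
  "orth_proj ip L =
    (THE P. \<forall>x. blinfun_apply P x \<in> L \<and> x - blinfun_apply P x \<in> orth_compl ip L)"

definition adj ::
  "('a::real_normed_vector \<Rightarrow> 'a \<Rightarrow> 'k::rc_field) \<Rightarrow> ('b::real_normed_vector \<Rightarrow> 'b \<Rightarrow> 'k)
    \<Rightarrow> ('a \<Rightarrow>\<^sub>L 'b) \<Rightarrow> ('b \<Rightarrow>\<^sub>L 'a)" where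
  "adj ipH ipK T =
    (THE S. \<forall>x y. ipK (blinfun_apply T x) y = ipH x (blinfun_apply S y))"

text \<open>
  The block of \<open>T\<close> from \<open>L\<close> to \<open>L'\<close>, extended by 0 on the orthogonal complement of \<open>L\<close> and
  regarded as a map into the whole of the second space. This changes neither its range nor its
  norm, and the adjoint of the extension is the extension of the adjoint.
\<close>

definition block ::
  "('a::real_normed_vector \<Rightarrow> 'a \<Rightarrow> 'k::rc_field) \<Rightarrow> ('b::real_normed_vector \<Rightarrow> 'b \<Rightarrow> 'k)
    \<Rightarrow> 'a set \<Rightarrow> 'b set \<Rightarrow> ('a \<Rightarrow>\<^sub>L 'b) \<Rightarrow> ('a \<Rightarrow>\<^sub>L 'b)" where
  "block ipH ipK L L' T = orth_proj ipK L' o\<^sub>L T o\<^sub>L orth_proj ipH L"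

abbreviation "blockB ipH ipK M N \<equiv> block ipH ipK (orth_compl ipH M) N"
abbreviation "blockC ipH ipK M N \<equiv> block ipH ipK M (orth_compl ipK N)"
abbreviation "blockD ipH ipK M N \<equiv> block ipH ipK (orth_compl ipH M) (orth_compl ipK N)"

definition unit_ball :: "'a::real_normed_vector set \<Rightarrow> 'a set" where
  "unit_ball L = {x\<in>L. norm x \<le> 1}"

definition psi_lambda ::
  "('k::rc_field \<Rightarrow> 'a::real_normed_vector \<Rightarrow> 'a) \<Rightarrow> ('a \<Rightarrow> 'a \<Rightarrow> 'k)
    \<Rightarrow> ('k \<Rightarrow> 'b::real_normed_vector \<Rightarrow> 'b) \<Rightarrow> ('b \<Rightarrow> 'b \<Rightarrow> 'k)
    \<Rightarrow> 'a set \<Rightarrow> 'b set \<Rightarrow> real \<Rightarrow> ('a \<Rightarrow>\<^sub>L 'b) set" where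
  "psi_lambda sH ipH sK ipK M N lam =
    {T \<in> bounded_ops sH sK.
      blockC ipH ipK M N T ` unit_ball M
        \<subseteq> (\<lambda>y. lam *\<^sub>R blockD ipH ipK M N T y) ` unit_ball (orth_compl ipH M) \<and>
      adj ipH ipK (blockB ipH ipK M N T) ` unit_ball N
        \<subseteq> (\<lambda>x. lam *\<^sub>R adj ipH ipK (blockD ipH ipK M N T) x) ` unit_ball (orth_compl ipK N)}"

definition is_projection_onto ::
  "('k::rc_field \<Rightarrow> 'a::real_normed_vector \<Rightarrow> 'a) \<Rightarrow> 'a set \<Rightarrow> ('a \<Rightarrow>\<^sub>L 'a) \<Rightarrow> bool" where
  "is_projection_onto s L P \<longleftrightarrow>
    P \<in> bounded_ops s s \<and> P o\<^sub>L P = P \<and> range (blinfun_apply P) = L"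

text \<open>The projections here need not be orthogonal.\<close>

definition psi ::
  "('k::rc_field \<Rightarrow> 'a::real_normed_vector \<Rightarrow> 'a) \<Rightarrow> ('k \<Rightarrow> 'b::real_normed_vector \<Rightarrow> 'b)
    \<Rightarrow> 'a set \<Rightarrow> 'b set \<Rightarrow> ('a \<Rightarrow>\<^sub>L 'b) set" where
  "psi sH sK M N =
    {T \<in> bounded_ops sH sK. \<exists>Pr Pl Mr Ml.
      is_projection_onto sH M Pr \<and> is_projection_onto sK N Pl \<and>
      Mr \<in> bounded_ops sH sH \<and> Ml \<in> bounded_ops sK sK \<and>
      (id_blinfun - Pr) o\<^sub>L Mr = Mr \<and>
      (id_blinfun - Pl) o\<^sub>L T o\<^sub>L Mr = (id_blinfun - Pl) o\<^sub>L T \<and>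
      Ml o\<^sub>L (id_blinfun - Pl) = Ml \<and>
      Ml o\<^sub>L T o\<^sub>L (id_blinfun - Pr) = T o\<^sub>L (id_blinfun - Pr)}"

end

theory Submission
  imports Defs
begin

text \<open>
  If \<open>C\<^sub>n u = \<lambda>\<^sub>n D\<^sub>n y\<^sub>n\<close> with \<open>y\<^sub>n\<close> in the unit ball, then \<open>C\<^sub>n u\<close> lies within
  \<open>\<lambda>\<^sub>n \<parallel>D - D\<^sub>n\<parallel>\<close> of the range of \<open>D\<close>; hence \<open>C u\<close> lies in the closed set \<open>R(D)\<close>.
  Pairing the condition on the adjoints with a vector \<open>x\<close> such that \<open>D x = 0\<close> gives
  \<open>\<parallel>B\<^sub>n x\<parallel> \<le> \<lambda>\<^sub>n \<parallel>D - D\<^sub>n\<parallel> \<parallel>x\<parallel>\<close>, so \<open>B\<close> vanishes on the kernel of \<open>D\<close>. As \<open>R(D)\<close> is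
  closed, \<open>D\<close> has a bounded generalised inverse \<open>G\<close>, and with the orthogonal projections
  \<open>P\<close> onto \<open>M\<close> and \<open>Q\<close> onto \<open>N\<close> the operators \<open>(I - P) G (I - Q) T\<close> and \<open>T (I - P) G (I - Q)\<close>
  witness complementability.
\<close>

section \<open>Open mapping theorem for operators with closed range\<close>

text \<open>The closed range is complete, and the closures of the images of the balls of radius
  \<open>n\<close> cover it, so by Baire one of them has interior relative to the range. This gives
  approximate preimages of controlled norm; correcting the remaining error again and again turns
  them into an exact one. The constant \<open>c\<close> later bounds the generalised
  inverse.\<close>

lemma closed_range_bounded_preimage:
  fixes f :: "'a::{real_normed_vector, complete_space} \<Rightarrow> 'b::{real_normed_vector, complete_space}"
  assumes f: "bounded_linear f" and cl: "closed (range f)"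
  obtains c where "c \<ge> 0" "\<And>y. y \<in> range f \<Longrightarrow> \<exists>x. f x = y \<and> norm x \<le> c * norm y"
proof -
  interpret f: bounded_linear f by (fact f)
  let ?Y = "range f"
  let ?F = "\<lambda>n::nat. ?Y \<inter> closure (f ` cball 0 (real n))"
  have "\<exists>n. top_of_set ?Y interior_of ?F n \<noteq> {}"
  proof (rule ccontr)
    assume empty: "\<not> ?thesis"
    have "completely_metrizable_space (top_of_set ?Y)"
      using cl by (simp add: completely_metrizable_space_closedin
          completely_metrizable_space_euclidean)
    then have "top_of_set ?Y interior_of \<Union> (range ?F) = {}"
      using empty by (intro Baire_category_alt) (auto intro: closedin_closed_Int)
    moreover have "\<Union> (range ?F) = ?Y"
    proof -
      have "f x \<in> \<Union> (range ?F)" for x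
      proof -
        obtain n where "norm x \<le> real n" using real_arch_simple by blast
        then have "f x \<in> ?F n" by (auto intro!: closure_subset[THEN subsetD])
        then show ?thesis by blast
      qed
      then show ?thesis by auto
    qed
    ultimately show False
      using interior_of_topspace[of "top_of_set ?Y"] by auto
  qed
  then obtain n y0 where "y0 \<in> top_of_set ?Y interior_of ?F n" by blast
  then obtain U where "openin (top_of_set ?Y) U" "y0 \<in> U" "U \<subseteq> ?F n"
    by (auto simp: interior_of_def)
  then obtain r where r: "r > 0" "y0 \<in> ?Y" "ball y0 r \<inter> ?Y \<subseteq> ?F n"
    by (meson order_trans openin_contains_ball subset_iff openin_subset)
  \<comment> \<open>The ball about \<open>y0\<close> is moved to the origin: \<open>y\<close> is
    half the difference of \<open>y0 + y\<close> and \<open>y0 - y\<close>, and half the difference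
    of their approximate preimages still has norm at most \<open>n\<close>.\<close>
  have approx_ball: "\<exists>x. norm x \<le> real n \<and> norm (y - f x) < e"
    if y: "y \<in> ?Y" "norm y < r" and e: "e > 0" for y e
  proof -
    have near: "\<exists>x. norm x \<le> real n \<and> norm (y0 + v - f x) < e" if "v \<in> ?Y" "norm v < r" for v
    proof -
      have "y0 + v \<in> ?Y" using r(2) that(1) by (auto simp flip: f.add)
      then have "y0 + v \<in> ball y0 r \<inter> ?Y"
        using that by (auto simp: dist_norm)
      then have "y0 + v \<in> closure (f ` cball 0 (real n))" using r by blast
      then show ?thesis
        using e by (fastforce simp: closure_approachable dist_norm norm_minus_commute)
    qed
    obtain x1 where x1: "norm x1 \<le> real n" "norm (y0 + y - f x1) < e" using near y by blast
    have "- y \<in> ?Y" using y by (auto simp flip: f.neg)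
    then obtain x2 where x2: "norm x2 \<le> real n" "norm (y0 + - y - f x2) < e"
      using near[of "- y"] y by auto
    let ?x = "(1/2) *\<^sub>R (x1 - x2)"
    have "norm ?x \<le> real n"
      using norm_triangle_ineq4[of x1 x2] x1 x2 by simp
    moreover have "y - f ?x = (1/2) *\<^sub>R ((y0 + y - f x1) - (y0 + - y - f x2))"
      by (simp add: f.scaleR f.diff algebra_simps flip: scaleR_add_left)
    then have "norm (y - f ?x) \<le> (1/2) * (norm (y0 + y - f x1) + norm (y0 + - y - f x2))"
      using norm_triangle_ineq4[of "y0 + y - f x1" "y0 + - y - f x2"] by simp
    then have "norm (y - f ?x) < e" using x1 x2 by simp
    ultimately show ?thesis by blast
  qed
  \<comment> \<open>A nonzero \<open>y\<close> is rescaled to norm \<open>r / 2\<close> and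
    approximated up to \<open>r / 4\<close>. Scaling back leaves an error of at most half of
    \<open>norm y\<close> and a preimage of norm at most \<open>n / t = K * norm y\<close>.\<close>
  define K where "K = 2 * real n / r"
  have K: "K \<ge> 0" using r by (simp add: K_def)
  have "\<exists>x. norm x \<le> K * norm y \<and> norm (y - f x) \<le> norm y / 2" if y: "y \<in> ?Y" for y
  proof (cases "y = 0")
    case True
    then show ?thesis by (intro exI[of _ 0]) (simp add: f.zero)
  next
    case False
    define t where "t = r / (2 * norm y)"
    have t: "t > 0" using r False by (simp add: t_def)
    have "norm (t *\<^sub>R y) < r" using r False by (simp add: t_def)
    moreover have "t *\<^sub>R y \<in> ?Y" using y by (auto simp flip: f.scaleR)
    ultimately obtain x where x: "norm x \<le> real n" "norm (t *\<^sub>R y - f x) < r / 4"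
      using approx_ball[of "t *\<^sub>R y" "r / 4"] r by auto
    have "norm ((1 / t) *\<^sub>R x) = norm x / t"
      using t by simp
    also have "\<dots> \<le> real n / t"
      using x t by (intro divide_right_mono) auto
    also have "\<dots> = K * norm y" by (simp add: K_def t_def)
    finally have "norm ((1 / t) *\<^sub>R x) \<le> K * norm y" .
    moreover have "y - f ((1 / t) *\<^sub>R x) = (1 / t) *\<^sub>R (t *\<^sub>R y - f x)"
      using t by (simp add: f.scaleR scaleR_diff_right)
    then have "norm (y - f ((1 / t) *\<^sub>R x)) = norm (t *\<^sub>R y - f x) / t"
      using t by simp
    moreover have "norm (t *\<^sub>R y - f x) / t \<le> (r / 4) / t"
      using x t by (intro divide_right_mono) auto
    moreover have "(r / 4) / t = norm y / 2" using r by (simp add: t_def)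
    ultimately show ?thesis by (intro exI[of _ "(1 / t) *\<^sub>R x"]) simp
  qed
  then obtain g where g: "\<And>y. y \<in> ?Y \<Longrightarrow> norm (g y) \<le> K * norm y"
    "\<And>y. y \<in> ?Y \<Longrightarrow> norm (y - f (g y)) \<le> norm y / 2" by metis
  have "\<exists>x. f x = y \<and> norm x \<le> (2 * K) * norm y" if y: "y \<in> ?Y" for y
  proof -
    \<comment> \<open>\<open>R k\<close> is the error left after \<open>k\<close> corrections and
      \<open>s m\<close> is the sum of the first \<open>m\<close> corrections. The errors halve, so
      the corrections are dominated by a geometric series of sum
      \<open>2 * K * norm y\<close>.\<close>
    define R where "R k = ((\<lambda>v. v - f (g v)) ^^ k) y" for k
    define s where "s m = (\<Sum>k<m. g (R k))" for m
    have R_Suc: "R (Suc k) = R k - f (g (R k))" for k by (simp add: R_def)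
    have RY: "R k \<in> ?Y" for k
      by (induction k) (use y in \<open>auto simp: R_def f.diff[symmetric]\<close>)
    have R_le: "norm (R k) \<le> norm y * (1/2)^k" for k
    proof (induction k)
      case (Suc k)
      then show ?case using g(2)[OF RY[of k]] by (simp add: R_Suc)
    qed (simp add: R_def)
    have fs: "f (s m) = y - R m" for m
      by (induction m) (simp_all add: s_def f.zero f.add R_Suc, simp add: R_def)
    \<comment> \<open>The subtracted power makes the induction close: the next correction is at most
      \<open>K * norm y * (1/2)^m\<close>, which is exactly the growth of the bound from
      \<open>m\<close> to \<open>Suc m\<close>.\<close>
    have s_diff: "norm (s m - s l) \<le> 2 * K * norm y * ((1/2)^l - (1/2)^m)" if "l \<le> m" for l m
      using that
    proof (induction m rule: dec_induct)
      case (step m)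
      have "norm (g (R m)) \<le> K * (norm y * (1/2)^m)"
        using g(1)[OF RY[of m]] mult_left_mono[OF R_le[of m] K] by linarith
      moreover have "s (Suc m) - s l = (s m - s l) + g (R m)" by (simp add: s_def)
      then have "norm (s (Suc m) - s l) \<le> norm (s m - s l) + norm (g (R m))"
        by (metis norm_triangle_ineq)
      ultimately show ?case using step.IH by (simp add: algebra_simps)
    qed simp
    have C0: "2 * K * norm y \<ge> 0" using K by simp
    have s_diff': "norm (s m - s l) \<le> 2 * K * norm y * (1/2)^l" if "l \<le> m" for l m
      using s_diff[OF that] mult_left_mono[OF _ C0, of "(1/2)^l - (1/2)^m" "(1/2)^l"] by simp
    have lim0: "(\<lambda>l. C * (1/2)^l) \<longlonglongrightarrow> 0" for C :: real
      by (intro tendsto_mult_right_zero LIMSEQ_power_zero) simp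
    have "Cauchy s"
    proof (rule metric_CauchyI)
      fix e :: real assume "e > 0"
      then have "\<forall>\<^sub>F l in sequentially. 4 * K * norm y * (1/2)^l < e"
        using order_tendstoD(2)[OF lim0] by blast
      then obtain L where L: "4 * K * norm y * (1/2)^L < e"
        by (auto simp: eventually_sequentially)
      have "dist (s m) (s l) < e" if "m \<ge> L" "l \<ge> L" for m l
        using dist_triangle2[of "s m" "s l" "s L"] s_diff'[OF that(1)] s_diff'[OF that(2)] L
        by (simp add: dist_norm norm_minus_commute)
      then show "\<exists>L. \<forall>m\<ge>L. \<forall>l\<ge>L. dist (s m) (s l) < e" by blast
    qed
    then obtain x where x: "s \<longlonglongrightarrow> x"
      using Cauchy_convergent convergent_def by blast
    have "R \<longlonglongrightarrow> 0"
      by (rule tendsto_norm_zero_cancel)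
         (rule tendsto_sandwich[OF _ _ tendsto_const lim0[of "norm y"]], use R_le in auto)
    then have "(\<lambda>m. f (s m)) \<longlonglongrightarrow> y" unfolding fs using tendsto_diff[OF tendsto_const] by fastforce
    moreover have "(\<lambda>m. f (s m)) \<longlonglongrightarrow> f x" using f.tendsto x by blast
    ultimately have "f x = y" using LIMSEQ_unique by blast
    moreover have "norm (s m) \<le> 2 * K * norm y" for m
      using s_diff'[of 0 m] by (simp add: s_def)
    then have "norm x \<le> 2 * K * norm y"
      using x by (intro LIMSEQ_le_const2[OF tendsto_norm]) auto
    ultimately show ?thesis by blast
  qed
  then show thesis using that[of "2 * K"] K by auto
qed

section \<open>Inner product geometry and orthogonal decomposition\<close>

lemma rcnj_zero [simp]: "rcnj (0 :: 'a::rc_field) = 0"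
  using rcnj_of_real[of 0, where 'a='a] by simp

context hilbert_space
begin

lemma ip_zero_left [simp]: "ip 0 y = 0"
  using ip_add_left[of 0 0 y] by simp

lemma ip_diff_left: "ip (x - y) z = ip x z - ip y z"
  using ip_add_left[of "x - y" y z] by simp

lemma ip_eq_0_commute: "ip x y = 0 \<longleftrightarrow> ip y x = 0"
  using ip_commute[of x y] ip_commute[of y x] by (metis rcnj_zero)

lemma ip_scale_right: "ip x (scale c y) = rcnj c * ip x y"
  by (metis ip_commute ip_scale_left rcnj_mult)

lemma ip_scaleR_right: "ip x (r *\<^sub>R y) = of_real r * ip x y"
  by (metis ip_scale_right rcnj_of_real scale_of_real)

lemma ip_add_right: "ip x (y + z) = ip x y + ip x z"
  by (metis ip_commute ip_add_left rcnj_add)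

lemma ip_diff_right: "ip x (y - z) = ip x y - ip x z"
  using ip_add_right[of x "y - z" z] by simp

lemma ip_self_eq_0 [simp]: "ip x x = 0 \<longleftrightarrow> x = 0"
  by (simp add: ip_self)

lemma eq_if_ip_eq:
  assumes "\<And>x. ip x y = ip x z"
  shows "y = z"
  using assms ip_self_eq_0[of "y - z"] by (simp add: ip_diff_right)

lemma pythagoras:
  assumes "ip x y = 0"
  shows "(norm (x + y))\<^sup>2 = (norm x)\<^sup>2 + (norm y)\<^sup>2"
proof -
  have "ip y x = 0" using assms ip_eq_0_commute by blast
  then have "(of_real ((norm (x + y))\<^sup>2) :: 'k) = of_real ((norm x)\<^sup>2 + (norm y)\<^sup>2)"
    using assms unfolding ip_self[symmetric] of_real_add by (simp add: ip_add_left ip_add_right)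
  then show ?thesis by (simp only: of_real_eq_iff)
qed

lemma parallelogram:
  fixes x y :: 'a
  shows "(norm (x + y))\<^sup>2 + (norm (x - y))\<^sup>2 = 2 * (norm x)\<^sup>2 + 2 * (norm y)\<^sup>2"
proof -
  have "ip (x + y) (x + y) + ip (x - y) (x - y) = ip x x + ip x x + (ip y y + ip y y)"
    by (simp add: ip_add_left ip_add_right ip_diff_left ip_diff_right)
  then have "(norm (x + y))\<^sup>2 + (norm (x - y))\<^sup>2 =
      (norm x)\<^sup>2 + (norm x)\<^sup>2 + ((norm y)\<^sup>2 + (norm y)\<^sup>2)"
    by (simp only: ip_self of_real_add[symmetric] of_real_eq_iff)
  then show ?thesis by simp
qed

lemma norm_scale: "norm (scale c x) = norm c * norm x"
proof -
  have "(of_real ((norm (scale c x))\<^sup>2) :: 'k) = c * rcnj c * ip x x"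
    by (simp only: ip_self[symmetric] ip_scale_left ip_scale_right mult_ac)
  also have "\<dots> = of_real ((norm c * norm x)\<^sup>2)"
    by (simp add: mult_rcnj ip_self power_mult_distrib)
  finally have "(norm (scale c x))\<^sup>2 = (norm c * norm x)\<^sup>2" by (simp only: of_real_eq_iff)
  then show ?thesis by (simp add: power2_eq_iff_nonneg)
qed

text \<open>Pythagoras for \<open>v\<close> split along \<open>u\<close>. It yields Cauchy-Schwarz,
  and it measures how much the distance to a subspace drops when a point is moved along
  \<open>u\<close>.\<close>

lemma norm_diff_component:
  assumes "u \<noteq> 0"
  shows "(norm (v - scale (ip v u / ip u u) u))\<^sup>2 = (norm v)\<^sup>2 - (norm (ip v u) / norm u)\<^sup>2"
proof -
  let ?c = "ip v u / ip u u"
  have "ip (v - scale ?c u) u = 0"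
    using assms by (simp add: ip_diff_left ip_scale_left)
  then have "ip (v - scale ?c u) (scale ?c u) = 0" by (simp add: ip_scale_right)
  from pythagoras[OF this]
  have "(norm v)\<^sup>2 = (norm (v - scale ?c u))\<^sup>2 + (norm ?c * norm u)\<^sup>2"
    by (simp add: norm_scale)
  moreover have "norm ?c * norm u = norm (ip v u) / norm u"
    using assms by (simp add: norm_divide ip_self norm_mult power2_eq_square)
  ultimately show ?thesis by simp
qed

lemma Cauchy_Schwarz: "norm (ip x y) \<le> norm x * norm y"
proof (cases "y = 0")
  case True
  then show ?thesis using ip_eq_0_commute[of x 0] by simp
next
  case False
  have "(norm (ip x y) / norm y)\<^sup>2 \<le> (norm x)\<^sup>2"
    using norm_diff_component[OF False, of x] by (metis diff_ge_0_iff_ge zero_le_power2)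
  then have "norm (ip x y) / norm y \<le> norm x" by (rule power2_le_imp_le) simp
  then show ?thesis using False by (simp add: divide_le_eq)
qed

lemma subspace_scaleR: "subspace L \<Longrightarrow> x \<in> L \<Longrightarrow> r *\<^sub>R x \<in> L"
  by (metis scale_of_real subspace_scale)

text \<open>The conditions in \<open>psi_lambda\<close> concern unit balls; normalising by
  \<open>sgn\<close> brings any vector there, and \<open>sgn 0 = 0\<close> covers the zero
  vector.\<close>

lemma sgn_in_unit_ball:
  assumes "subspace L" "x \<in> L"
  shows "sgn x \<in> unit_ball L"
proof -
  have "sgn x \<in> L" using assms by (simp add: sgn_div_norm subspace_scaleR)
  then show ?thesis by (simp add: unit_ball_def norm_sgn)
qed

text \<open>A sequence in \<open>L\<close> minimising the squared distance to \<open>x\<close> is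
  Cauchy by the parallelogram law. Its limit is a nearest point of \<open>L\<close>, and minimality
  forces the remainder to be orthogonal to \<open>L\<close>.\<close>

lemma ex_orth_decomp:
  assumes L: "subspace L" "closed L"
  shows "\<exists>p\<in>L. x - p \<in> orth_compl ip L"
proof -
  define d where "d = (INF y\<in>L. (norm (x - y))\<^sup>2)"
  have bdd: "bdd_below ((\<lambda>y. (norm (x - y))\<^sup>2) ` L)" by (rule bdd_belowI[of _ 0]) auto
  have ne: "L \<noteq> {}" using subspace_0[OF L(1)] by blast
  have d_le: "d \<le> (norm (x - y))\<^sup>2" if "y \<in> L" for y
    unfolding d_def using bdd that by (rule cINF_lower)
  have "\<exists>y\<in>L. (norm (x - y))\<^sup>2 < d + inverse (real (Suc n))" for n
    using cINF_less_iff[OF ne bdd, of "d + inverse (real (Suc n))"] unfolding d_def by simp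
  then obtain y where y: "\<And>n. y n \<in> L" "\<And>n. (norm (x - y n))\<^sup>2 < d + inverse (real (Suc n))"
    by metis
  \<comment> \<open>The midpoint of \<open>y m\<close> and \<open>y n\<close> lies in
    \<open>L\<close>, so its squared distance to \<open>x\<close> is at least \<open>d\<close>; the
    parallelogram law then leaves only the two excesses over \<open>d\<close>.\<close>
  have diff: "(norm (y m - y n))\<^sup>2 \<le> 2 * inverse (real (Suc m)) + 2 * inverse (real (Suc n))"
    for m n
  proof -
    have "(1/2) *\<^sub>R (y m + y n) \<in> L" using y L by (simp add: subspace_add subspace_scaleR)
    then have "d \<le> (norm (x - (1/2) *\<^sub>R (y m + y n)))\<^sup>2" by (rule d_le)
    moreover have "(x - y m) + (x - y n) = 2 *\<^sub>R (x - (1/2) *\<^sub>R (y m + y n))"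
      by (simp add: algebra_simps scaleR_2)
    then have "(norm ((x - y m) + (x - y n)))\<^sup>2 = 4 * (norm (x - (1/2) *\<^sub>R (y m + y n)))\<^sup>2"
      by (simp add: power_mult_distrib)
    moreover have "norm ((x - y m) - (x - y n)) = norm (y m - y n)"
      by (simp add: norm_minus_commute)
    ultimately show ?thesis
      using parallelogram[of "x - y m" "x - y n"] y(2)[of m] y(2)[of n] by simp
  qed
  have "Cauchy y"
  proof (rule metric_CauchyI)
    fix e :: real assume e: "e > 0"
    then obtain k where k: "inverse (real (Suc k)) < e\<^sup>2 / 4"
      using reals_Archimedean[of "e\<^sup>2 / 4"] by auto
    have "dist (y m) (y n) < e" if "m \<ge> k" "n \<ge> k" for m n
    proof -
      have "inverse (real (Suc m)) \<le> inverse (real (Suc k))"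
        "inverse (real (Suc n)) \<le> inverse (real (Suc k))"
        using that by (auto intro!: le_imp_inverse_le)
      then have "(norm (y m - y n))\<^sup>2 < e\<^sup>2" using diff[of m n] k by linarith
      then show ?thesis using e by (simp add: dist_norm power2_less_imp_less)
    qed
    then show "\<exists>k. \<forall>m\<ge>k. \<forall>n\<ge>k. dist (y m) (y n) < e" by blast
  qed
  then obtain p where p: "y \<longlonglongrightarrow> p"
    using Cauchy_convergent convergent_def by blast
  have pL: "p \<in> L" using closed_sequentially[OF L(2) _ p] y by blast
  have "(\<lambda>n. (norm (x - y n))\<^sup>2) \<longlonglongrightarrow> (norm (x - p))\<^sup>2"
    using p by (intro tendsto_intros)
  moreover have "(\<lambda>n. d + inverse (real (Suc n))) \<longlonglongrightarrow> d + 0"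
    by (intro tendsto_add tendsto_const LIMSEQ_inverse_real_of_nat)
  ultimately have p_le: "(norm (x - p))\<^sup>2 \<le> d"
    using LIMSEQ_le[of "\<lambda>n. (norm (x - y n))\<^sup>2" _ "\<lambda>n. d + inverse (real (Suc n))"]
      less_imp_le[OF y(2)] by fastforce
  have "ip (x - p) u = 0" if u: "u \<in> L" for u
  proof (cases "u = 0")
    case True
    then show ?thesis using ip_eq_0_commute[of _ 0] by simp
  next
    case False
    \<comment> \<open>\<open>?w\<close> is the component of \<open>x - p\<close> along
      \<open>u\<close>. Were it nonzero, \<open>p + ?w\<close> would be closer to \<open>x\<close>
      than \<open>p\<close>.\<close>
    let ?w = "scale (ip (x - p) u / ip u u) u"
    have "p + ?w \<in> L" using pL u L by (simp add: subspace_add subspace_scale)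
    then have "d \<le> (norm (x - p - ?w))\<^sup>2" using d_le by (simp add: diff_diff_eq)
    then have "(norm (ip (x - p) u) / norm u)\<^sup>2 \<le> 0"
      using norm_diff_component[OF False, of "x - p"] p_le by linarith
    then show ?thesis using False by simp
  qed
  then show ?thesis using pL by (auto simp: orth_compl_def)
qed

lemma subspace_orth_compl: "subspace (orth_compl ip L)"
  by (rule subspaceI) (auto simp: orth_compl_def ip_add_left ip_scale_left)

text \<open>The difference of two candidates lies in \<open>L\<close> and is orthogonal to
  \<open>L\<close>, hence to itself. Linearity of the projection and the evaluation of the
  \<open>THE\<close> in \<open>orth_proj\<close> rest on this.\<close>

lemma orth_decomp_unique:
  assumes "subspace L" "p \<in> L" "q \<in> L" "x - p \<in> orth_compl ip L" "x - q \<in> orth_compl ip L"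
  shows "p = q"
proof -
  have "p - q \<in> L" using assms by (simp add: subspace_diff)
  moreover have "(x - q) - (x - p) \<in> orth_compl ip L"
    by (rule subspace_diff[OF subspace_orth_compl]) (use assms in auto)
  ultimately have "ip (p - q) (p - q) = 0" by (simp add: orth_compl_def)
  then show ?thesis by simp
qed

end

section \<open>Bounded operators between two Hilbert spaces\<close>

text \<open>It is also interpreted with the two spaces equal or exchanged, so that the same facts
  serve projections, adjoints and generalised inverses.\<close>

locale hilbert_pair = H: hilbert_space sH ipH + K: hilbert_space sK ipK
  for sH :: "'k::rc_field \<Rightarrow> 'a::{real_normed_vector, complete_space} \<Rightarrow> 'a"
    and ipH :: "'a \<Rightarrow> 'a \<Rightarrow> 'k"
    and sK :: "'k \<Rightarrow> 'b::{real_normed_vector, complete_space} \<Rightarrow> 'b"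
    and ipK :: "'b \<Rightarrow> 'b \<Rightarrow> 'k"
begin

lemma bounded_ops_iff: "T \<in> bounded_ops sH sK \<longleftrightarrow> (\<forall>c x. T (sH c x) = sK c (T x))"
  by (auto simp: bounded_ops_def Vector_Spaces.linear_iff H.vector_space_axioms
      K.vector_space_axioms blinfun.add_right)

text \<open>Turns a map built pointwise by choice into an operator. Homogeneity over the reals comes
  from that over \<open>'k\<close> at the scalars \<open>of_real r\<close>.\<close>

lemma ex_bounded_op:
  assumes "\<And>x y. f (x + y) = f x + f y" "\<And>c x. f (sH c x) = sK c (f x)"
    and "\<And>x. norm (f x) \<le> norm x * C"
  shows "\<exists>F\<in>bounded_ops sH sK. \<forall>x. blinfun_apply F x = f x"
proof -
  have "bounded_linear f"
  proof (rule bounded_linear_intro)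
    show "f (r *\<^sub>R x) = r *\<^sub>R f x" for r x
      using assms(2)[of "of_real r" x] by (simp add: H.scale_of_real K.scale_of_real)
  qed (use assms in auto)
  then have "blinfun_apply (Blinfun f) = f" by (rule bounded_linear_Blinfun_apply)
  then show ?thesis using assms(2) by (intro bexI[of _ "Blinfun f"]) (auto simp: bounded_ops_iff)
qed

end

section \<open>Orthogonal projections and the Riesz representation\<close>

context hilbert_space
begin

text \<open>The points chosen from \<open>ex_orth_decomp\<close> depend linearly on \<open>x\<close>
  by uniqueness and contractively by Pythagoras, so they form a bounded operator, which is the one
  that the \<open>THE\<close> denotes.\<close>

lemma orth_proj:
  assumes L: "subspace L" "closed L"
  shows orth_proj_in: "orth_proj ip L x \<in> L"
    and orth_proj_diff: "x - orth_proj ip L x \<in> orth_compl ip L"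
    and orth_proj_bounded_ops: "orth_proj ip L \<in> bounded_ops scale scale"
proof -
  interpret hilbert_pair scale ip scale ip ..
  obtain p where p: "\<And>x. p x \<in> L" "\<And>x. x - p x \<in> orth_compl ip L"
    using ex_orth_decomp[OF L] by metis
  have "\<exists>P\<in>bounded_ops scale scale. \<forall>x. blinfun_apply P x = p x"
  proof (rule ex_bounded_op)
    fix x y c
    have "(x - p x) + (y - p y) \<in> orth_compl ip L"
      using p by (intro subspace_add subspace_orth_compl)
    then have "(x + y) - (p x + p y) \<in> orth_compl ip L" by (simp add: algebra_simps)
    then show "p (x + y) = p x + p y"
      using p L by (intro orth_decomp_unique[OF L(1), of _ _ "x + y"]) (auto simp: subspace_add)
    have "scale c (x - p x) \<in> orth_compl ip L"
      using p by (intro subspace_scale subspace_orth_compl)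
    then show "p (scale c x) = scale c (p x)"
      using p L by (intro orth_decomp_unique[OF L(1), of _ _ "scale c x"])
        (auto simp: subspace_scale scale_right_diff_distrib)
    have "ip (x - p x) (p x) = 0" using p by (simp add: orth_compl_def)
    from pythagoras[OF this] have "(norm (p x))\<^sup>2 \<le> (norm x)\<^sup>2" by simp
    then show "norm (p x) \<le> norm x * 1" by (auto intro: power2_le_imp_le)
  qed
  then obtain P where P: "P \<in> bounded_ops scale scale" "\<And>x. blinfun_apply P x = p x" by blast
  have "orth_proj ip L = P"
    unfolding orth_proj_def
  proof (rule the_equality)
    fix P' assume "\<forall>x. blinfun_apply P' x \<in> L \<and> x - blinfun_apply P' x \<in> orth_compl ip L"
    then show "P' = P"
      using p P(2) orth_decomp_unique[OF L(1)] by (intro blinfun_eqI) metis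
  qed (use p P in auto)
  then show "orth_proj ip L x \<in> L" "x - orth_proj ip L x \<in> orth_compl ip L"
    "orth_proj ip L \<in> bounded_ops scale scale"
    using p P by auto
qed

lemma norm_orth_proj_le:
  assumes "subspace L" "closed L"
  shows "norm (orth_proj ip L x) \<le> norm x"
proof -
  have "ip (x - orth_proj ip L x) (orth_proj ip L x) = 0"
    using orth_proj_in[OF assms, of x] orth_proj_diff[OF assms, of x] by (simp add: orth_compl_def)
  from pythagoras[OF this] have "(norm (orth_proj ip L x))\<^sup>2 \<le> (norm x)\<^sup>2" by simp
  then show ?thesis by (auto intro: power2_le_imp_le)
qed

lemma orth_proj_eqI:
  assumes "subspace L" "closed L" "p \<in> L" "x - p \<in> orth_compl ip L"
  shows "orth_proj ip L x = p"
  using assms orth_proj_in orth_proj_diff orth_decomp_unique by blast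

lemma orth_proj_id: "subspace L \<Longrightarrow> closed L \<Longrightarrow> x \<in> L \<Longrightarrow> orth_proj ip L x = x"
  by (rule orth_proj_eqI) (auto simp: subspace_0 subspace_orth_compl)

text \<open>\<open>L\<close> is contained in its double complement, so I - P meets the description
  of the projection onto the complement. All blocks can thus be written with the projections onto
  \<open>M\<close> and \<open>N\<close> alone.\<close>

lemma orth_proj_orth_compl:
  assumes L: "subspace L" "closed L"
  shows "orth_proj ip (orth_compl ip L) = id_blinfun - orth_proj ip L"
proof -
  have Lc: "u \<in> orth_compl ip (orth_compl ip L)" if "u \<in> L" for u
    using that ip_eq_0_commute by (auto simp: orth_compl_def)
  show ?thesis
    unfolding orth_proj_def[of ip "orth_compl ip L"]
  proof (rule the_equality)
    show "\<forall>x. blinfun_apply (id_blinfun - orth_proj ip L) x \<in> orth_compl ip L \<and>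
      x - blinfun_apply (id_blinfun - orth_proj ip L) x \<in> orth_compl ip (orth_compl ip L)"
      using orth_proj[OF L] Lc by (auto simp: blinfun.diff_left)
    fix P' assume P': "\<forall>x. blinfun_apply P' x \<in> orth_compl ip L \<and>
      x - blinfun_apply P' x \<in> orth_compl ip (orth_compl ip L)"
    show "P' = id_blinfun - orth_proj ip L"
    proof (rule blinfun_eqI)
      fix x
      show "blinfun_apply P' x = blinfun_apply (id_blinfun - orth_proj ip L) x"
        using P' orth_proj_in[OF L, of x] orth_proj_diff[OF L, of x] Lc
        by (intro orth_decomp_unique[OF subspace_orth_compl, of _ L _ x])
           (auto simp: blinfun.diff_left)
    qed
  qed
qed

text \<open>For \<open>f\<close> not identically zero, let \<open>e\<close> be the part of some
  \<open>a\<close> with \<open>f a\<close> nonzero that is orthogonal to the kernel. Every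
  \<open>x\<close> differs from a multiple of \<open>e\<close> by a kernel vector, so
  \<open>f\<close> is a multiple of the pairing with \<open>e\<close>.\<close>

lemma riesz_representation:
  fixes f :: "'a \<Rightarrow> 'k"
  assumes add: "\<And>x y. f (x + y) = f x + f y" and scale: "\<And>c x. f (scale c x) = c * f x"
    and bound: "\<And>x. norm (f x) \<le> norm x * C"
  shows "\<exists>y. \<forall>x. f x = ip x y"
proof (cases "\<forall>x. f x = 0")
  case True
  then show ?thesis using ip_eq_0_commute[of _ 0] by (intro exI[of _ 0]) simp
next
  case False
  then obtain a where a: "f a \<noteq> 0" by blast
  have "bounded_linear f"
  proof (rule bounded_linear_intro)
    show "f (r *\<^sub>R x) = r *\<^sub>R f x" for r x
      using scale[of "of_real r" x] by (simp add: scale_of_real scaleR_conv_of_real)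
  qed (use assms in auto)
  then interpret f: bounded_linear f .
  let ?L = "{x. f x = 0}"
  have L: "subspace ?L" by (rule subspaceI) (auto simp: add scale f.zero)
  have "closed ?L" by (intro closed_Collect_eq continuous_intros f.continuous_on)
  then obtain p where p: "f p = 0" "a - p \<in> orth_compl ip ?L"
    using ex_orth_decomp[OF L, of a] by blast
  define e where "e = a - p"
  have fe: "f e = f a" using p by (simp add: e_def f.diff)
  then have e0: "e \<noteq> 0" using a f.zero by auto
  \<comment> \<open>The conjugate compensates for \<open>ip\<close> being conjugate linear in its
    second argument.\<close>
  have "f x = ip x (scale (rcnj (f e / ip e e)) e)" for x
  proof -
    have "x - scale (f x / f e) e \<in> ?L" using a fe by (simp add: f.diff scale)
    then have "ip e (x - scale (f x / f e) e) = 0" using p by (simp add: orth_compl_def e_def)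
    then have "ip (x - scale (f x / f e) e) e = 0" using ip_eq_0_commute by blast
    then have "ip x e = f x / f e * ip e e" by (simp add: ip_diff_left ip_scale_left)
    then show ?thesis using e0 a fe by (simp add: ip_scale_right rcnj_rcnj)
  qed
  then show ?thesis by blast
qed

end

section \<open>Adjoints and generalised inverses\<close>

context hilbert_pair
begin

text \<open>Riesz gives the value \<open>s y\<close> for each \<open>y\<close>. Its linearity in
  \<open>y\<close> follows from uniqueness, its bound from testing at \<open>x = s y\<close> and
  cancelling \<open>norm (s y)\<close>; so the \<open>THE\<close> in \<open>adj\<close> is well
  defined.\<close>

lemma adj:
  assumes T: "T \<in> bounded_ops sH sK"
  shows "ipK (T x) y = ipH x (adj ipH ipK T y)"
proof -
  interpret KH: hilbert_pair sK ipK sH ipH ..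
  have "\<exists>z. \<forall>x. ipK (T x) y = ipH x z" for y
  proof (rule H.riesz_representation)
    show "norm (ipK (T x) y) \<le> norm x * (norm T * norm y)" for x
      using order_trans[OF K.Cauchy_Schwarz mult_right_mono[OF norm_blinfun[of T x], of "norm y"]]
      by (simp add: mult_ac)
  qed (use T in \<open>auto simp: blinfun.add_right K.ip_add_left K.ip_scale_left bounded_ops_iff\<close>)
  then obtain s where s: "\<And>x y. ipK (T x) y = ipH x (s y)" by metis
  have "\<exists>S\<in>bounded_ops sK sH. \<forall>y. blinfun_apply S y = s y"
  proof (rule KH.ex_bounded_op)
    fix y z c
    show "s (y + z) = s y + s z"
      by (rule H.eq_if_ip_eq) (simp add: H.ip_add_right K.ip_add_right flip: s)
    show "s (sK c y) = sH c (s y)"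
      by (rule H.eq_if_ip_eq) (simp add: H.ip_scale_right K.ip_scale_right flip: s)
    have "norm (ipH (s y) (s y)) \<le> norm (T (s y)) * norm y"
      unfolding s[symmetric] by (rule K.Cauchy_Schwarz)
    also have "\<dots> \<le> norm T * norm (s y) * norm y"
      by (intro mult_right_mono norm_blinfun) simp
    finally have "norm (s y) * norm (s y) \<le> norm (s y) * (norm y * norm T)"
      by (simp add: H.ip_self norm_mult power2_eq_square mult_ac)
    then show "norm (s y) \<le> norm y * norm T"
      by (cases "s y = 0") (auto simp: mult_le_cancel_left)
  qed
  then obtain S :: "'b \<Rightarrow>\<^sub>L 'a" where S: "\<And>y. blinfun_apply S y = s y" by blast
  have "adj ipH ipK T = S"
    unfolding adj_def
  proof (rule the_equality)
    fix S' :: "'b \<Rightarrow>\<^sub>L 'a"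
    assume "\<forall>x y. ipK (T x) y = ipH x (S' y)"
    then show "S' = S" using S s by (intro blinfun_eqI H.eq_if_ip_eq) metis
  qed (use S s in auto)
  then show ?thesis using S s by simp
qed

text \<open>\<open>G y\<close> is the one preimage, orthogonal to the kernel of \<open>D\<close>, of
  the projection of \<open>y\<close> onto the range of \<open>D\<close>. It is bounded because
  preimages of controlled norm exist.\<close>

lemma closed_range_right_inverse:
  assumes D: "D \<in> bounded_ops sH sK" and cl: "closed (range (blinfun_apply D))"
  shows "\<exists>G\<in>bounded_ops sK sH. \<forall>x. D (G (D x)) = D x"
proof -
  interpret KH: hilbert_pair sK ipK sH ipH ..
  have D_scale: "D (sH c x) = sK c (D x)" for c x using D by (simp add: bounded_ops_iff)
  let ?Y = "range (blinfun_apply D)"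
  have Y: "K.subspace ?Y"
  proof (rule K.subspaceI)
    show "0 \<in> ?Y" by (metis blinfun.zero_right rangeI)
  qed (auto simp flip: blinfun.add_right D_scale)
  let ?Z = "{x. blinfun_apply D x = 0}"
  have Z: "H.subspace ?Z"
    using D_scale by (intro H.subspaceI) (auto simp: blinfun.zero_right blinfun.add_right)
  have clZ: "closed ?Z" by (intro closed_Collect_eq continuous_intros)
  note Zc = H.subspace_orth_compl[of ?Z]
  let ?R = "orth_proj ipK ?Y"
  have R_scale: "?R (sK c y) = sK c (?R y)" for c y
    using K.orth_proj_bounded_ops[OF Y cl] hilbert_pair.bounded_ops_iff[of sK ipK sK ipK ?R]
      K.hilbert_space_axioms by (simp add: hilbert_pair_def)
  obtain c where c: "c \<ge> 0" "\<And>y. y \<in> ?Y \<Longrightarrow> \<exists>x. D x = y \<and> norm x \<le> c * norm y"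
    using closed_range_bounded_preimage[OF blinfun.bounded_linear_right cl] by blast
  have "\<exists>x. x \<in> orth_compl ipH ?Z \<and> D x = ?R y \<and> norm x \<le> norm y * c" for y
  proof -
    obtain x where x: "D x = ?R y" "norm x \<le> c * norm (?R y)"
      using c(2) K.orth_proj_in[OF Y cl] by blast
    \<comment> \<open>Removing the kernel component of \<open>x\<close> neither changes
      \<open>D x\<close> nor increases the norm.\<close>
    let ?P = "orth_proj ipH ?Z"
    have "D (?P x) = 0" using H.orth_proj_in[OF Z clZ, of x] by simp
    then have "D (x - ?P x) = ?R y" using x by (simp add: blinfun.diff_right)
    moreover have "norm (x - ?P x) \<le> norm x"
    proof -
      have "ipH (x - ?P x) (?P x) = 0"
        using H.orth_proj_in[OF Z clZ, of x] H.orth_proj_diff[OF Z clZ, of x] by (simp add: orth_compl_def)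
      from H.pythagoras[OF this] have "(norm (x - ?P x))\<^sup>2 \<le> (norm x)\<^sup>2" by simp
      then show ?thesis by (auto intro: power2_le_imp_le)
    qed
    moreover have "c * norm (?R y) \<le> norm y * c"
      using K.norm_orth_proj_le[OF Y cl, of y] c(1) by (simp add: mult_left_mono mult.commute)
    ultimately show ?thesis
      using x H.orth_proj_diff[OF Z clZ, of x] by (intro exI[of _ "x - ?P x"]) auto
  qed
  then obtain g where g: "\<And>y. g y \<in> orth_compl ipH ?Z" "\<And>y. D (g y) = ?R y"
    "\<And>y. norm (g y) \<le> norm y * c" by metis
  \<comment> \<open>\<open>D\<close> is injective on the complement of its kernel; linearity of
    \<open>g\<close> is therefore checked after applying \<open>D\<close>.\<close>
  have unique: "u = v" if "u \<in> orth_compl ipH ?Z" "v \<in> orth_compl ipH ?Z" "D u = D v" for u v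
  proof -
    have "u - v \<in> orth_compl ipH ?Z" using that Zc by (intro H.subspace_diff)
    moreover have "u - v \<in> ?Z" using that by (simp add: blinfun.diff_right)
    ultimately have "ipH (u - v) (u - v) = 0" by (simp add: orth_compl_def)
    then show ?thesis by simp
  qed
  have "\<exists>G\<in>bounded_ops sK sH. \<forall>y. blinfun_apply G y = g y"
  proof (rule KH.ex_bounded_op)
    show "g (y + z) = g y + g z" for y z
      by (rule unique) (auto simp: g blinfun.add_right intro: H.subspace_add Zc)
    show "g (sK a y) = sH a (g y)" for a y
      by (rule unique) (auto simp: g D_scale R_scale intro: H.subspace_scale Zc)
  qed (fact g)
  then show ?thesis using g(2) K.orth_proj_id[OF Y cl] by (metis rangeI)
qed

end

section \<open>Complementability of the norm limit\<close>

theorem theorem3p5: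
  fixes sH :: "'k::rc_field \<Rightarrow> 'a::{real_normed_vector, complete_space} \<Rightarrow> 'a"
    and ipH :: "'a \<Rightarrow> 'a \<Rightarrow> 'k"
    and sK :: "'k \<Rightarrow> 'b::{real_normed_vector, complete_space} \<Rightarrow> 'b"
    and ipK :: "'b \<Rightarrow> 'b \<Rightarrow> 'k"
    and M :: "'a set" and N :: "'b set"
    and lam :: "nat \<Rightarrow> real"
    and Tn :: "nat \<Rightarrow> 'a \<Rightarrow>\<^sub>L 'b" and T :: "'a \<Rightarrow>\<^sub>L 'b"
  assumes "hilbert_space sH ipH" and "hilbert_space sK ipK"
    and "module.subspace sH M" and "closed M"
    and "module.subspace sK N" and "closed N"
    and "\<And>n. lam n > 0"
    and "\<And>n. Tn n \<in> psi_lambda sH ipH sK ipK M N (lam n)"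
    and "T \<in> bounded_ops sH sK"
    and "closed (range (blinfun_apply (blockD ipH ipK M N T)))"
    and "Tn \<longlonglongrightarrow> T"
    and "(\<lambda>n. lam n * norm (blockD ipH ipK M N T - blockD ipH ipK M N (Tn n))) \<longlonglongrightarrow> 0"
  shows "T \<in> psi sH sK M N"
proof -
  interpret hilbert_pair sH ipH sK ipK using assms(1,2) by (rule hilbert_pair.intro)
  interpret HH: hilbert_pair sH ipH sH ipH ..
  interpret KK: hilbert_pair sK ipK sK ipK ..
  note M = assms(3,4) and N = assms(5,6) and lam = assms(7)
  let ?P = "orth_proj ipH M" and ?Q = "orth_proj ipK N"
  let ?B = "blockB ipH ipK M N" and ?C = "blockC ipH ipK M N" and ?D = "blockD ipH ipK M N"
  have B: "?B S x = ?Q (S (x - ?P x))"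
    and C: "?C S x = S (?P x) - ?Q (S (?P x))"
    and D: "?D S x = S (x - ?P x) - ?Q (S (x - ?P x))" for S x
    by (simp_all add: block_def H.orth_proj_orth_compl[OF M] K.orth_proj_orth_compl[OF N]
        blinfun.diff_left)
  have PP: "?P (?P x) = ?P x" for x by (intro H.orth_proj_id M H.orth_proj_in[OF M])
  have QQ: "?Q (?Q x) = ?Q x" for x by (intro K.orth_proj_id N K.orth_proj_in[OF N])
  have P_ops: "?P \<in> bounded_ops sH sH" and Q_ops: "?Q \<in> bounded_ops sK sK"
    using H.orth_proj_bounded_ops[OF M] K.orth_proj_bounded_ops[OF N] by auto
  then have P_scale: "?P (sH c x) = sH c (?P x)" and Q_scale: "?Q (sK c y) = sK c (?Q y)" for c x y
    by (auto simp: HH.bounded_ops_iff KK.bounded_ops_iff)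
  have B_ops: "?B S \<in> bounded_ops sH sK" and D_ops: "?D S \<in> bounded_ops sH sK"
    if "S \<in> bounded_ops sH sK" for S
    using that by (auto simp: bounded_ops_iff B D P_scale Q_scale
        simp flip: H.scale_right_diff_distrib K.scale_right_diff_distrib)
  define \<delta> where "\<delta> n = lam n * norm (?D T - ?D (Tn n))" for n
  have \<delta>: "\<delta> \<longlonglongrightarrow> 0" using assms(12) unfolding \<delta>_def .
  have \<delta>_bound: "lam n * norm (?D T x - ?D (Tn n) x) \<le> \<delta> n * norm x" for n x
    using mult_left_mono[OF norm_blinfun[of "?D T - ?D (Tn n)" x] less_imp_le[OF lam[of n]]]
    by (simp add: \<delta>_def blinfun.diff_left mult.assoc)
  have Tn_ops: "Tn n \<in> bounded_ops sH sK" for n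
    using assms(8)[of n] by (simp add: psi_lambda_def)

  have C_unit: "?C T u \<in> range (?D T)" if u: "u \<in> unit_ball M" for u
  proof -
    have "\<exists>y. norm y \<le> 1 \<and> ?C (Tn n) u = lam n *\<^sub>R ?D (Tn n) y" for n
      using assms(8)[of n] u by (fastforce simp: psi_lambda_def unit_ball_def)
    then obtain y where y: "\<And>n. norm (y n) \<le> 1"
      "\<And>n. ?C (Tn n) u = lam n *\<^sub>R ?D (Tn n) (y n)" by metis
    \<comment> \<open>The vectors \<open>lam n *\<^sub>R y n\<close> may be unbounded and need not
      converge. Only their images under \<open>?D T\<close> do, and closedness of the range is
      enough.\<close>
    have "norm (?C (Tn n) u - ?D T (lam n *\<^sub>R y n)) \<le> \<delta> n" for n
    proof -
      have "norm (?C (Tn n) u - ?D T (lam n *\<^sub>R y n)) =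
          lam n * norm (?D T (y n) - ?D (Tn n) (y n))"
        unfolding y(2) blinfun.scaleR_right scaleR_diff_right[symmetric]
        using lam[of n] by (simp add: norm_minus_commute)
      also have "\<dots> \<le> \<delta> n * norm (y n)" by (rule \<delta>_bound)
      also have "\<dots> \<le> \<delta> n"
        using y(1)[of n] lam[of n] by (simp add: \<delta>_def mult_left_le)
      finally show ?thesis .
    qed
    then have diff: "(\<lambda>n. ?C (Tn n) u - ?D T (lam n *\<^sub>R y n)) \<longlonglongrightarrow> 0"
      by (intro Lim_null_comparison[OF _ \<delta>] always_eventually) auto
    have "(\<lambda>n. ?C (Tn n) u) \<longlonglongrightarrow> ?C T u"
      unfolding C by (intro tendsto_intros assms(11))
    from tendsto_diff[OF this diff] have lim: "(\<lambda>n. ?D T (lam n *\<^sub>R y n)) \<longlonglongrightarrow> ?C T u" by simp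
    show ?thesis by (rule closed_sequentially[OF assms(10) _ lim]) (rule rangeI)
  qed
  \<comment> \<open>\<open>?C T\<close> sees only the component of \<open>x\<close> in
    \<open>M\<close>, which is a multiple of a vector in the unit ball.\<close>
  have C_range: "?C T x \<in> range (?D T)" for x
  proof -
    let ?u = "?P x"
    have "sgn ?u \<in> unit_ball M"
      by (intro H.sgn_in_unit_ball M(1) H.orth_proj_in[OF M])
    then obtain y where y: "?C T (sgn ?u) = ?D T y" using C_unit by blast
    have "norm ?u *\<^sub>R sgn ?u = ?u"
      by (cases "?u = 0") (simp_all add: sgn_div_norm)
    then have "?C T x = ?C T (norm ?u *\<^sub>R sgn ?u)" by (simp add: C PP)
    also have "\<dots> = ?D T (norm ?u *\<^sub>R y)" by (simp only: blinfun.scaleR_right y)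
    finally show ?thesis by blast
  qed

  have ker: "?B T x = 0" if x: "?D T x = 0" for x
  proof -
    have "norm (?B (Tn n) x) \<le> \<delta> n * norm x" for n
    proof -
      let ?v = "?B (Tn n) x"
      have "?v \<in> N" unfolding B by (rule K.orth_proj_in[OF N])
      then have "sgn ?v \<in> unit_ball N"
        by (rule K.sgn_in_unit_ball[OF N(1)])
      then obtain w where w: "norm w \<le> 1"
        "adj ipH ipK (?B (Tn n)) (sgn ?v) = lam n *\<^sub>R adj ipH ipK (?D (Tn n)) w"
        using assms(8)[of n] by (fastforce simp: psi_lambda_def unit_ball_def)
      \<comment> \<open>Pairing \<open>?v\<close> with its own direction returns its norm. Passing
        to the adjoint of the B block, replacing it by \<open>lam n\<close> times that of the D
        block at \<open>w\<close>, and passing back leaves \<open>lam n\<close> times the pairing of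
        \<open>?D (Tn n) x\<close> with \<open>w\<close>.\<close>
      have "ipK ?v (sgn ?v) = of_real (norm ?v)"
        by (cases "?v = 0") (simp_all add: sgn_div_norm K.ip_scaleR_right K.ip_self power2_eq_square)
      then have "norm ?v = norm (ipK ?v (sgn ?v))" by simp
      also have "ipK ?v (sgn ?v) = of_real (lam n) * ipK (?D (Tn n) x) w"
        by (simp add: adj[OF B_ops[OF Tn_ops]] adj[OF D_ops[OF Tn_ops]] w H.ip_scaleR_right)
      also have "norm \<dots> = lam n * norm (ipK (?D (Tn n) x) w)"
        using lam[of n] by (simp add: norm_mult)
      also have "\<dots> \<le> lam n * norm (?D (Tn n) x)"
        using K.Cauchy_Schwarz[of "?D (Tn n) x" w] w(1) lam[of n]
          mult_left_le[OF w(1) norm_ge_zero[of "?D (Tn n) x"]]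
        by (intro mult_left_mono) auto
      \<comment> \<open>Since \<open>?D T x = 0\<close>, the vector \<open>?D (Tn n) x\<close> is,
        up to sign, the difference of the two D blocks at \<open>x\<close>.\<close>
      also have "\<dots> \<le> \<delta> n * norm x" using \<delta>_bound[of n x] x by simp
      finally show ?thesis .
    qed
    then have "(\<lambda>n. ?B (Tn n) x) \<longlonglongrightarrow> 0"
      by (intro Lim_null_comparison[OF _ tendsto_mult_left_zero[OF \<delta>]] always_eventually) auto
    moreover have "(\<lambda>n. ?B (Tn n) x) \<longlonglongrightarrow> ?B T x"
      unfolding B by (intro tendsto_intros assms(11))
    ultimately show ?thesis using LIMSEQ_unique by blast
  qed

  obtain G where G: "G \<in> bounded_ops sK sH" "\<And>x. ?D T (G (?D T x)) = ?D T x"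
    using closed_range_right_inverse[OF D_ops[OF assms(9)] assms(10)] by blast
  \<comment> \<open>(I - Q) T is the sum of the C and D blocks, so its values lie in the range of
    \<open>?D T\<close>, where \<open>?D T\<close> after \<open>G\<close> is the identity.\<close>
  have DG: "?D T (G (T x - ?Q (T x))) = T x - ?Q (T x)" for x
  proof -
    obtain y where y: "?C T x = ?D T y" using C_range by blast
    have "T x - ?Q (T x) = ?C T x + ?D T x" by (simp add: C D blinfun.diff_right)
    also have "\<dots> = ?D T (y + x)" by (simp add: y blinfun.add_right)
    finally show ?thesis using G(2) by simp
  qed
  \<comment> \<open>\<open>G (?D T x) - x\<close> lies in the kernel of \<open>?D T\<close>, hence
    in that of \<open>?B T\<close>. The two blocks add up to T (I - P), which therefore vanishes
    there too.\<close>
  have GD: "T (G (?D T x) - ?P (G (?D T x))) = T (x - ?P x)" for x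
  proof -
    let ?v = "G (?D T x) - x"
    have "?D T ?v = 0" using G(2) by (simp add: blinfun.diff_right)
    moreover from this have "?B T ?v = 0" by (rule ker)
    moreover have "?B T ?v + ?D T ?v = T (?v - ?P ?v)" by (simp add: B D)
    ultimately have "T (?v - ?P ?v) = 0" by simp
    then show ?thesis by (simp add: blinfun.diff_right blinfun.add_right algebra_simps)
  qed
  \<comment> \<open>\<open>DG\<close> and \<open>GD\<close> become the two equations of
    \<open>psi\<close> that involve \<open>T\<close> on both sides. The factor I - P on the left of
    \<open>Mr\<close> and the factor I - Q on the right of \<open>Ml\<close> give the other two by
    idempotence.\<close>
  define Mr where "Mr = (id_blinfun - ?P) o\<^sub>L G o\<^sub>L (id_blinfun - ?Q) o\<^sub>L T"
  define Ml where "Ml = T o\<^sub>L (id_blinfun - ?P) o\<^sub>L G o\<^sub>L (id_blinfun - ?Q)"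
  have Mr: "Mr x = G (T x - ?Q (T x)) - ?P (G (T x - ?Q (T x)))" for x
    by (simp add: Mr_def blinfun.diff_left)
  have Ml: "Ml y = T (G (y - ?Q y) - ?P (G (y - ?Q y)))" for y
    by (simp add: Ml_def blinfun.diff_left)
  interpret KH: hilbert_pair sK ipK sH ipH ..
  have T_scale: "T (sH c x) = sK c (T x)" and G_scale: "G (sK c y) = sH c (G y)" for c x y
    using assms(9) G(1) by (auto simp: bounded_ops_iff KH.bounded_ops_iff)
  have "is_projection_onto sH M ?P"
    using P_ops PP H.orth_proj_in[OF M] H.orth_proj_id[OF M]
    by (auto simp: is_projection_onto_def intro!: blinfun_eqI) (metis rangeI)
  moreover have "is_projection_onto sK N ?Q"
    using Q_ops QQ K.orth_proj_in[OF N] K.orth_proj_id[OF N]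
    by (auto simp: is_projection_onto_def intro!: blinfun_eqI) (metis rangeI)
  moreover have "Mr \<in> bounded_ops sH sH"
    by (simp add: HH.bounded_ops_iff Mr T_scale G_scale P_scale Q_scale
        flip: H.scale_right_diff_distrib K.scale_right_diff_distrib)
  moreover have "Ml \<in> bounded_ops sK sK"
    by (simp add: KK.bounded_ops_iff Ml T_scale G_scale P_scale Q_scale
        flip: H.scale_right_diff_distrib K.scale_right_diff_distrib)
  moreover have "(id_blinfun - ?P) o\<^sub>L Mr = Mr"
    by (rule blinfun_eqI) (simp add: Mr blinfun.diff_left blinfun.diff_right PP)
  moreover have "(id_blinfun - ?Q) o\<^sub>L T o\<^sub>L Mr = (id_blinfun - ?Q) o\<^sub>L T"
  proof (rule blinfun_eqI)
    fix x
    show "((id_blinfun - ?Q) o\<^sub>L T o\<^sub>L Mr) x = ((id_blinfun - ?Q) o\<^sub>L T) x"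
      using DG[of x] unfolding D Mr[symmetric] by (simp add: blinfun.diff_left)
  qed
  moreover have "Ml o\<^sub>L (id_blinfun - ?Q) = Ml"
    by (rule blinfun_eqI) (simp add: Ml blinfun.diff_left blinfun.diff_right QQ)
  moreover have "Ml o\<^sub>L T o\<^sub>L (id_blinfun - ?P) = T o\<^sub>L (id_blinfun - ?P)"
  proof (rule blinfun_eqI)
    fix x
    show "(Ml o\<^sub>L T o\<^sub>L (id_blinfun - ?P)) x = (T o\<^sub>L (id_blinfun - ?P)) x"
      using GD[of x] by (simp add: Ml D blinfun.diff_left)
  qed
  ultimately show ?thesis using assms(9) unfolding psi_def by blast
qed

end
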